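(* Let $M$ be a Markov evolution algebra and let $G=(V,E)$ be the directed graph associated to $M$. Then $G$ has no closed induced subgraph if and only if the evolution algebra $M$ is simple.
   Context: A Markov evolution algebra is a real algebra $M$ with a finite nonempty basis $\{e_i\mid i\in\Lambda\}$ (its set of generators) and products $e_i\cdot e_j=0$ for $i\ne j$, $e_i^2=\sum_{k\in\Lambda}p_{ik}e_k$, where $0\le p_{ik}\le 1$ and $\sum_{k\in\Lambda}p_{ik}=1$ for all $i$. Its associated directed graph is $(V,E)$ with $V=\{e_i\mid i\in\Lambda\}$ and $(e_i,e_j)\in E$ if and only if $e_j$ appears in $e_i^2$, i.e. $p_{ij}\ne 0$. For a nonempty $V'\subsetneq V$, the subgraph induced by $V'$ is closed if $(e_i,e_j)\notin E$ for all $e_i\in V'$ and $e_j\in V\setminus V'$. An evolution subalgebra of $M$ is a subalgebra that is the linear span of a subset of the generators. An evolution ideal is an evolution subalgebra $I$ with $M\cdot I\subseteq I$. $M$ is simple if it has no evolution ideals other than $0$ and $M$. *)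

theory Defs
  imports "HOL-Analysis.Analysis" "Graph_Theory.Digraph_Component"
begin

text \<open>
  The algebra is the whole type \<open>'a\<close>, with a bilinear product \<open>mul\<close> that is not assumed
  associative or unital (the class \<open>real_algebra\<close> would force associativity).
  The values of \<open>p\<close> outside \<open>\<Lambda> \<times> \<Lambda>\<close> are irrelevant.
\<close>

locale evolution_algebra =
  fixes mul :: "'a::real_vector \<Rightarrow> 'a \<Rightarrow> 'a"
    and \<Lambda> :: "'i set"
    and e :: "'i \<Rightarrow> 'a"
    and p :: "'i \<Rightarrow> 'i \<Rightarrow> real"
  assumes bilinear_mul: "bilinear mul"
    and finite_index: "finite \<Lambda>"
    and index_nonempty: "\<Lambda> \<noteq> {}"
    and inj_generators: "inj_on e \<Lambda>"
    and independent_generators: "independent (e ` \<Lambda>)"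
    and span_generators: "span (e ` \<Lambda>) = UNIV"
    and mul_distinct: "\<lbrakk>i \<in> \<Lambda>; j \<in> \<Lambda>; i \<noteq> j\<rbrakk> \<Longrightarrow> mul (e i) (e j) = 0"
    and mul_square: "i \<in> \<Lambda> \<Longrightarrow> mul (e i) (e i) = (\<Sum>k\<in>\<Lambda>. p i k *\<^sub>R e k)"

locale markov_evolution_algebra = evolution_algebra +
  assumes p_nonneg: "\<lbrakk>i \<in> \<Lambda>; k \<in> \<Lambda>\<rbrakk> \<Longrightarrow> 0 \<le> p i k"
    and p_le_one: "\<lbrakk>i \<in> \<Lambda>; k \<in> \<Lambda>\<rbrakk> \<Longrightarrow> p i k \<le> 1"
    and p_row_sum: "i \<in> \<Lambda> \<Longrightarrow> (\<Sum>k\<in>\<Lambda>. p i k) = 1"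

definition associated_graph ::
    "'i set \<Rightarrow> ('i \<Rightarrow> 'a) \<Rightarrow> ('i \<Rightarrow> 'i \<Rightarrow> real) \<Rightarrow> 'a pair_pre_digraph" where
  "associated_graph \<Lambda> e p =
     \<lparr>pverts = e ` \<Lambda>, parcs = {(e i, e j) | i j. i \<in> \<Lambda> \<and> j \<in> \<Lambda> \<and> p i j \<noteq> 0}\<rparr>"

definition closed_induced_subgraph ::
    "('a, 'b) pre_digraph \<Rightarrow> ('a, 'b) pre_digraph \<Rightarrow> bool" where
  "closed_induced_subgraph H G \<longleftrightarrow>
     induced_subgraph H G \<and> verts H \<noteq> {} \<and> verts H \<subset> verts G \<and>
     (\<forall>u \<in> verts H. \<forall>v \<in> verts G - verts H. (u, v) \<notin> arcs_ends G)"

definition subalgebra :: "('a::real_vector \<Rightarrow> 'a \<Rightarrow> 'a) \<Rightarrow> 'a set \<Rightarrow> bool" where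
  "subalgebra mul A \<longleftrightarrow> subspace A \<and> (\<forall>x \<in> A. \<forall>y \<in> A. mul x y \<in> A)"

text \<open>Below, \<open>V\<close> is the set of generators; the subset \<open>S\<close> of it may be empty, giving \<open>{0}\<close>.\<close>

definition evolution_subalgebra ::
    "('a::real_vector \<Rightarrow> 'a \<Rightarrow> 'a) \<Rightarrow> 'a set \<Rightarrow> 'a set \<Rightarrow> bool" where
  "evolution_subalgebra mul V A \<longleftrightarrow> subalgebra mul A \<and> (\<exists>S \<subseteq> V. A = span S)"

definition evolution_ideal ::
    "('a::real_vector \<Rightarrow> 'a \<Rightarrow> 'a) \<Rightarrow> 'a set \<Rightarrow> 'a set \<Rightarrow> bool" where
  "evolution_ideal mul V I \<longleftrightarrow>
     evolution_subalgebra mul V I \<and> (\<forall>x. \<forall>y \<in> I. mul x y \<in> I)"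

definition simple_evolution_algebra ::
    "('a::real_vector \<Rightarrow> 'a \<Rightarrow> 'a) \<Rightarrow> 'a set \<Rightarrow> bool" where
  "simple_evolution_algebra mul V \<longleftrightarrow>
     (\<forall>I. evolution_ideal mul V I \<longrightarrow> I = {0} \<or> I = UNIV)"

end

theory Submission
  imports Defs
begin

text \<open>
  Closed induced subgraphs and proper nonzero evolution ideals are both governed by sets \<open>W\<close> of
  generators that no arc leaves. On the graph side, such a \<open>W\<close> is the vertex set of an induced
  subgraph, and it determines that subgraph. On the algebra side the corresponding ideal is
  \<open>span W\<close>. Multiplying \<open>e\<^sub>i\<close> by an arbitrary element of the algebra only ever produces a multiple of
  \<open>e\<^sub>i\<^sup>2\<close>, since the other products \<open>e\<^sub>j e\<^sub>i\<close> vanish. Hence \<open>span W\<close> is an ideal exactly when it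
  contains the squares of the generators in \<open>W\<close>, and by linear independence this says that every
  generator occurring in such a square lies in \<open>W\<close>, that is, that no arc leaves \<open>W\<close>
  (lemma \<open>evolution_ideal_span_iff\<close>).

  Linear independence also gives \<open>span W = {0}\<close> only for empty \<open>W\<close>, and \<open>span W = UNIV\<close> only when
  \<open>W\<close> contains all generators. So simplicity means that the only sets of generators without
  outgoing arcs are the two trivial ones, which is the condition on the graph.
\<close>

lemma (in wf_digraph) closed_induced_subgraph_iff_vertex_set:
  "(\<exists>H. closed_induced_subgraph H G) \<longleftrightarrow>
     (\<exists>W. W \<noteq> {} \<and> W \<subset> verts G \<and> (\<forall>u\<in>W. \<forall>v\<in>verts G - W. (u, v) \<notin> arcs_ends G))"
proof
  assume "\<exists>H. closed_induced_subgraph H G"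
  then show "\<exists>W. W \<noteq> {} \<and> W \<subset> verts G \<and> (\<forall>u\<in>W. \<forall>v\<in>verts G - W. (u, v) \<notin> arcs_ends G)"
    unfolding closed_induced_subgraph_def by blast
next
  assume "\<exists>W. W \<noteq> {} \<and> W \<subset> verts G \<and> (\<forall>u\<in>W. \<forall>v\<in>verts G - W. (u, v) \<notin> arcs_ends G)"
  then obtain W where "W \<noteq> {}" "W \<subset> verts G"
      "\<forall>u\<in>W. \<forall>v\<in>verts G - W. (u, v) \<notin> arcs_ends G"
    by blast
  then have "closed_induced_subgraph (G \<restriction> W) G"
    unfolding closed_induced_subgraph_def by (simp add: induced_induce psubset_imp_subset)
  then show "\<exists>H. closed_induced_subgraph H G" ..
qed

lemma wf_digraph_associated_graph: "wf_digraph (with_proj (associated_graph \<Lambda> e p))"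
  by unfold_locales (auto simp: associated_graph_def)

context evolution_algebra
begin

lemma arc_iff:
  assumes "i \<in> \<Lambda>" "j \<in> \<Lambda>"
  shows "(e i, e j) \<in> parcs (associated_graph \<Lambda> e p) \<longleftrightarrow> p i j \<noteq> 0"
  using assms by (auto simp: associated_graph_def dest: inj_onD[OF inj_generators])

lemma generator_not_in_span:
  assumes "j \<in> \<Lambda>" "W \<subseteq> e ` \<Lambda>" "e j \<notin> W"
  shows "e j \<notin> span W"
proof -
  have "e j \<notin> span (e ` \<Lambda> - {e j})"
    using independent_generators assms(1) unfolding dependent_def by blast
  moreover have "span W \<subseteq> span (e ` \<Lambda> - {e j})"
    using assms(2,3) by (intro span_mono) blast
  ultimately show ?thesis by blast
qed

text \<open>
  If \<open>c j\<close> were nonzero, one could solve for \<open>e j\<close> in terms of the other generators: both the sum,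
  by hypothesis, and its remaining terms lie in their span.
\<close>

lemma coefficient_eq_0:
  assumes "j \<in> \<Lambda>" "W \<subseteq> e ` \<Lambda>" "e j \<notin> W" and sum: "(\<Sum>k\<in>\<Lambda>. c k *\<^sub>R e k) \<in> span W"
  shows "c j = 0"
proof (rule ccontr)
  assume "c j \<noteq> 0"
  let ?B = "e ` \<Lambda> - {e j}"
  have "(\<Sum>k\<in>\<Lambda>. c k *\<^sub>R e k) \<in> span ?B"
    using sum span_mono[of W ?B] assms(2,3) by blast
  moreover have "(\<Sum>k\<in>\<Lambda> - {j}. c k *\<^sub>R e k) \<in> span ?B"
    using inj_onD[OF inj_generators] assms(1)
    by (intro span_sum span_scale span_base) blast
  moreover have "(\<Sum>k\<in>\<Lambda>. c k *\<^sub>R e k) = c j *\<^sub>R e j + (\<Sum>k\<in>\<Lambda> - {j}. c k *\<^sub>R e k)"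
    using finite_index assms(1) by (rule sum.remove)
  ultimately have "c j *\<^sub>R e j \<in> span ?B"
    by (metis add_diff_cancel_right' span_diff)
  then have "e j \<in> span ?B"
    using span_scale[of "c j *\<^sub>R e j" ?B "inverse (c j)"] \<open>c j \<noteq> 0\<close> by simp
  then show False
    using generator_not_in_span[of j ?B] assms(1) by blast
qed

lemma generator_square_in_span_iff:
  assumes "i \<in> \<Lambda>" "W \<subseteq> e ` \<Lambda>"
  shows "mul (e i) (e i) \<in> span W \<longleftrightarrow> (\<forall>j\<in>\<Lambda>. e j \<notin> W \<longrightarrow> p i j = 0)"
proof
  assume "mul (e i) (e i) \<in> span W"
  then show "\<forall>j\<in>\<Lambda>. e j \<notin> W \<longrightarrow> p i j = 0"
    using coefficient_eq_0[OF _ assms(2)] mul_square[OF assms(1)] by auto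
next
  assume *: "\<forall>j\<in>\<Lambda>. e j \<notin> W \<longrightarrow> p i j = 0"
  have "p i k *\<^sub>R e k \<in> span W" if "k \<in> \<Lambda>" for k
    using * that by (cases "e k \<in> W") (auto intro: span_scale span_base simp: span_zero)
  then show "mul (e i) (e i) \<in> span W"
    unfolding mul_square[OF assms(1)] by (intro span_sum)
qed

text \<open>
  Bilinearity reduces membership in \<open>span W\<close> of all products to that of products of generators,
  and among these only the squares are nonzero.
\<close>

lemma mul_in_span:
  assumes "W \<subseteq> e ` \<Lambda>"
    and squares: "\<And>i. i \<in> \<Lambda> \<Longrightarrow> e i \<in> W \<Longrightarrow> mul (e i) (e i) \<in> span W"
    and "y \<in> span W"
  shows "mul x y \<in> span W"
proof -
  interpret l: linear "\<lambda>a. mul a b" for b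
    using bilinear_mul by (simp add: bilinear_def)
  interpret r: linear "mul a" for a
    using bilinear_mul by (simp add: bilinear_def)
  have generator: "mul x (e i) \<in> span W" if i: "i \<in> \<Lambda>" "e i \<in> W" for x i
  proof -
    have "x \<in> span (e ` \<Lambda>)"
      by (simp add: span_generators)
    then show ?thesis
    proof (induction rule: span_induct_alt)
      case base
      show ?case by (simp add: l.zero span_zero)
    next
      case (step c u v)
      then obtain j where j: "j \<in> \<Lambda>" "u = e j" by blast
      have "mul u (e i) \<in> span W"
        using j i squares mul_distinct[of j i] by (cases "j = i") (auto simp: span_zero)
      with step show ?case
        unfolding l.add l.scale by (intro span_add span_scale)
    qed
  qed
  from \<open>y \<in> span W\<close> show ?thesis
  proof (induction rule: span_induct_alt)
    case base
    show ?case by (simp add: r.zero span_zero)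
  next
    case (step c u v)
    with \<open>W \<subseteq> e ` \<Lambda>\<close> have "mul x u \<in> span W"
      using generator by blast
    with step show ?case
      unfolding r.add r.scale by (intro span_add span_scale)
  qed
qed

lemma evolution_ideal_span_iff:
  assumes W: "W \<subseteq> e ` \<Lambda>"
  shows "evolution_ideal mul (e ` \<Lambda>) (span W) \<longleftrightarrow>
    (\<forall>u\<in>W. \<forall>v\<in>e ` \<Lambda> - W. (u, v) \<notin> parcs (associated_graph \<Lambda> e p))"
proof -
  have "evolution_ideal mul (e ` \<Lambda>) (span W) \<longleftrightarrow> (\<forall>x. \<forall>y\<in>span W. mul x y \<in> span W)"
    using W by (auto simp: evolution_ideal_def evolution_subalgebra_def subalgebra_def)
  also have "\<dots> \<longleftrightarrow> (\<forall>i\<in>\<Lambda>. e i \<in> W \<longrightarrow> mul (e i) (e i) \<in> span W)"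
    using mul_in_span[OF W] span_base by blast
  also have "\<dots> \<longleftrightarrow> (\<forall>i\<in>\<Lambda>. e i \<in> W \<longrightarrow> (\<forall>j\<in>\<Lambda>. e j \<notin> W \<longrightarrow> p i j = 0))"
    using generator_square_in_span_iff[OF _ W] by auto
  also have "\<dots> \<longleftrightarrow> (\<forall>u\<in>W. \<forall>v\<in>e ` \<Lambda> - W. (u, v) \<notin> parcs (associated_graph \<Lambda> e p))"
    using W arc_iff by blast
  finally show ?thesis .
qed

lemma span_eq_zero_iff:
  assumes "W \<subseteq> e ` \<Lambda>"
  shows "span W = {0} \<longleftrightarrow> W = {}"
proof
  assume "span W = {0}"
  then have "W \<subseteq> {0}"
    using span_superset by blast
  moreover have "0 \<notin> W"
    using independent_generators assms dependent_zero by blast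
  ultimately show "W = {}" by blast
qed simp

lemma span_eq_UNIV_iff:
  assumes "W \<subseteq> e ` \<Lambda>"
  shows "span W = UNIV \<longleftrightarrow> W = e ` \<Lambda>"
  using assms generator_not_in_span span_generators by blast

lemma simple_evolution_algebra_iff:
  "simple_evolution_algebra mul (e ` \<Lambda>) \<longleftrightarrow>
     (\<forall>W \<subseteq> e ` \<Lambda>. evolution_ideal mul (e ` \<Lambda>) (span W) \<longrightarrow> W = {} \<or> W = e ` \<Lambda>)"
proof -
  have "simple_evolution_algebra mul (e ` \<Lambda>) \<longleftrightarrow>
     (\<forall>W \<subseteq> e ` \<Lambda>. evolution_ideal mul (e ` \<Lambda>) (span W) \<longrightarrow> span W = {0} \<or> span W = UNIV)"
    unfolding simple_evolution_algebra_def evolution_ideal_def evolution_subalgebra_def by blast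
  then show ?thesis
    using span_eq_zero_iff span_eq_UNIV_iff by simp
qed

end

theorem theorem2p22:
  fixes mul :: "'a::real_vector \<Rightarrow> 'a \<Rightarrow> 'a"
    and \<Lambda> :: "'i set"
    and e :: "'i \<Rightarrow> 'a"
    and p :: "'i \<Rightarrow> 'i \<Rightarrow> real"
  assumes "markov_evolution_algebra mul \<Lambda> e p"
  shows "(\<nexists>H. closed_induced_subgraph H (with_proj (associated_graph \<Lambda> e p)))
         \<longleftrightarrow> simple_evolution_algebra mul (e ` \<Lambda>)"
proof -
  interpret markov_evolution_algebra mul \<Lambda> e p by fact
  let ?G = "associated_graph \<Lambda> e p"
  have verts: "pverts ?G = e ` \<Lambda>"
    by (simp add: associated_graph_def)
  have "(\<exists>H. closed_induced_subgraph H (with_proj ?G)) \<longleftrightarrow>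
      (\<exists>W. W \<noteq> {} \<and> W \<subset> e ` \<Lambda> \<and> (\<forall>u\<in>W. \<forall>v\<in>e ` \<Lambda> - W. (u, v) \<notin> parcs ?G))"
    using wf_digraph.closed_induced_subgraph_iff_vertex_set[OF wf_digraph_associated_graph]
    by (metis verts with_proj_simps(1,3))
  also have "\<dots> \<longleftrightarrow> (\<exists>W. W \<noteq> {} \<and> W \<subset> e ` \<Lambda> \<and> evolution_ideal mul (e ` \<Lambda>) (span W))"
    using evolution_ideal_span_iff by (meson psubset_imp_subset)
  also have "\<dots> \<longleftrightarrow> \<not> simple_evolution_algebra mul (e ` \<Lambda>)"
    unfolding simple_evolution_algebra_iff by blast
  finally show ?thesis by blast
qed

end
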